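(* Let $p,g_1,\ldots,g_m$ be real polynomials in $x=(x_1,\ldots,x_n)$ and let $S=\{x\in\mathbb{R}^n: g_i(x)\ge0,\ i=1,\ldots,m\}$. Suppose $R>0$ is such that $\sum_{i=1}^n x_i^2\le R$ for all $x\in S$, and let $\eta_1,\ldots,\eta_m,\beta\in\mathbb{R}$ satisfy $g_i(x)\le\eta_i$ and $-p(x)\le\beta$ for all $x\in S$. Let $d\ge1$ be such that $2d$ is the smallest positive even integer larger than or equal to the maximum degree of $p,g_1,\ldots,g_m$. Define the form $h=h(z)$ in the $n+m+3$ variables $z=(z_1,\ldots,z_{n+m+3})=(x_1,\ldots,x_n,s_0,\ldots,s_{m+1},y)$ by $$h(x,s,y):=\left(y^{2d}p(x/y)+s_0^2y^{2d-2}\right)^2+\sum_{i=1}^m\left(y^{2d}g_i(x/y)-s_i^2y^{2d-2}\right)^2+\left(\Big(R+\sum_{i=1}^m\eta_i+\beta\Big)^dy^{2d}-\Big(\sum_{i=1}^n x_i^2+\sum_{i=0}^m s_i^2\Big)^d-s_{m+1}^{2d}\right)^2.$$ Then $p(x)>0$ for all $x\in S$ if and only if there exists a positive integer $r$ such that the polynomial $$\left(h(v^2-w^2)-\frac1r\Big(\sum_{i=1}^{n+m+3}(v_i^2-w_i^2)^2\Big)^{2d}+\frac1{2r}\Big(\sum_{i=1}^{n+m+3}(v_i^4+w_i^4)\Big)^{2d}\right)\cdot\left(\sum_{i=1}^{n+m+3}v_i^2+\sum_{i=1}^{n+m+3}w_i^2\right)^{r^2}$$ in the variables $(v,w)\in\mathbb{R}^{2(n+m+3)}$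 has nonnegative coefficients.
   Context: $h(v^2-w^2)$ denotes $h$ evaluated at $z_i=v_i^2-w_i^2$, $i=1,\ldots,n+m+3$. For a polynomial $q$ of degree at most $2d$, $y^{2d}q(x/y)$ denotes its homogenization to degree $2d$ with the variable $y$. *)

theory Defs
  imports "HOL-Analysis.Analysis" "HOL-Library.Poly_Mapping"
begin

text \<open>
  Real polynomials in finitely many variables indexed by a type \<open>'v\<close>: finitely supported maps
  from exponent vectors to coefficients, with the convolution product of
  \<open>HOL-Library.Poly_Mapping\<close>.
\<close>

type_synonym 'v mpoly = "('v \<Rightarrow>\<^sub>0 nat) \<Rightarrow>\<^sub>0 real"

definition Var :: "'v \<Rightarrow> 'v mpoly" where
  "Var i = Poly_Mapping.single (Poly_Mapping.single i 1) 1"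

definition Const :: "real \<Rightarrow> 'v mpoly" where
  "Const c = Poly_Mapping.single 0 c"

definition mpoly_coeff :: "'v mpoly \<Rightarrow> ('v \<Rightarrow>\<^sub>0 nat) \<Rightarrow> real" where
  "mpoly_coeff q mon = Poly_Mapping.lookup q mon"

definition mon_degree :: "('v \<Rightarrow>\<^sub>0 nat) \<Rightarrow> nat" where
  "mon_degree mon = (\<Sum>i\<in>Poly_Mapping.keys mon. Poly_Mapping.lookup mon i)"

text \<open>The zero polynomial has total degree 0.\<close>

definition total_degree :: "'v mpoly \<Rightarrow> nat" where
  "total_degree q = Max (insert 0 (mon_degree ` Poly_Mapping.keys q))"

definition mpoly_eval :: "('v \<Rightarrow> real) \<Rightarrow> 'v mpoly \<Rightarrow> real" where
  "mpoly_eval a q = (\<Sum>mon\<in>Poly_Mapping.keys q. mpoly_coeff q mon *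
      (\<Prod>i\<in>Poly_Mapping.keys mon. a i ^ Poly_Mapping.lookup mon i))"

definition mpoly_subst :: "('v \<Rightarrow> 'w mpoly) \<Rightarrow> 'v mpoly \<Rightarrow> 'w mpoly" where
  "mpoly_subst f q = (\<Sum>mon\<in>Poly_Mapping.keys q. Const (mpoly_coeff q mon) *
      (\<Prod>i\<in>Poly_Mapping.keys mon. f i ^ Poly_Mapping.lookup mon i))"

text \<open>
  For \<open>q\<close> of degree at most \<open>k\<close>, the homogenization \<open>y\<^sup>k q(x/y)\<close>, where the polynomials \<open>f i\<close>
  stand for the \<open>x\<^sub>i\<close>. The truncated difference \<open>k - mon_degree mon\<close> is only meaningful under
  this degree bound.
\<close>

definition homogenization :: "nat \<Rightarrow> ('v \<Rightarrow> 'w mpoly) \<Rightarrow> 'w mpoly \<Rightarrow> 'v mpoly \<Rightarrow> 'w mpoly" where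
  "homogenization k f y q = (\<Sum>mon\<in>Poly_Mapping.keys q. Const (mpoly_coeff q mon) *
      (\<Prod>i\<in>Poly_Mapping.keys mon. f i ^ Poly_Mapping.lookup mon i) * y ^ (k - mon_degree mon))"

definition semialg_set :: "('m \<Rightarrow> 'n::finite mpoly) \<Rightarrow> (real ^ 'n) set" where
  "semialg_set g = {x. \<forall>i. 0 \<le> mpoly_eval (($) x) (g i)}"

text \<open>
  Names of the \<open>n + m + 3\<close> variables \<open>(x\<^sub>1, \<dots>, x\<^sub>n, s\<^sub>0, s\<^sub>1, \<dots>, s\<^sub>m, s\<^bsub>m+1\<^esub>, y)\<close>, where \<open>'n\<close> has
  \<open>n\<close> and \<open>'m\<close> has \<open>m\<close> elements: \<open>Slack0\<close> is \<open>s\<^sub>0\<close>, \<open>Slack i\<close> is the \<open>s\<^sub>i\<close> belonging to the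
  constraint \<open>g\<^sub>i\<close>, and \<open>SlackLast\<close> is \<open>s\<^bsub>m+1\<^esub>\<close>.
\<close>

datatype ('n, 'm) zvar = X 'n | Slack0 | Slack 'm | SlackLast | Y

lemma UNIV_zvar:
  "(UNIV :: ('n, 'm) zvar set) = range X \<union> range Slack \<union> {Slack0, SlackLast, Y}"
proof -
  have "z \<in> range X \<union> range Slack \<union> {Slack0, SlackLast, Y}" for z :: "('n, 'm) zvar"
    by (cases z) auto
  then show ?thesis by blast
qed

instance zvar :: (finite, finite) finite
  by standard (simp add: UNIV_zvar)

lemma card_zvar: "CARD(('n::finite, 'm::finite) zvar) = CARD('n) + CARD('m) + 3"
proof -
  have "card (range X \<union> range Slack :: ('n, 'm) zvar set) = CARD('n) + CARD('m)"
    by (subst card_Un_disjoint) (auto simp: card_image inj_on_def)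
  then show ?thesis
    unfolding UNIV_zvar by (subst card_Un_disjoint) auto
qed

definition h_form ::
    "'n::finite mpoly \<Rightarrow> ('m::finite \<Rightarrow> 'n mpoly) \<Rightarrow> real \<Rightarrow> ('m \<Rightarrow> real) \<Rightarrow> real \<Rightarrow> nat
      \<Rightarrow> ('n, 'm) zvar mpoly" where
  "h_form p g R \<eta> \<beta> d =
    (let x = (\<lambda>i. Var (X i)); s0 = Var Slack0; s = (\<lambda>i. Var (Slack i));
         s_last = Var SlackLast; y = Var Y
     in (homogenization (2*d) x y p + s0^2 * y^(2*d - 2))^2
        + (\<Sum>i\<in>UNIV. (homogenization (2*d) x y (g i) - (s i)^2 * y^(2*d - 2))^2)
        + (Const ((R + (\<Sum>i\<in>UNIV. \<eta> i) + \<beta>)^d) * y^(2*d)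
            - ((\<Sum>i\<in>UNIV. (x i)^2) + (s0^2 + (\<Sum>i\<in>UNIV. (s i)^2)))^d
            - s_last^(2*d))^2)"

text \<open>
  For each variable \<open>z\<^sub>i\<close> there are two new ones, \<open>v\<^sub>i\<close> (index \<open>Inl i\<close>) and \<open>w\<^sub>i\<close> (index \<open>Inr i\<close>).
\<close>

definition certificate_poly :: "'z::finite mpoly \<Rightarrow> nat \<Rightarrow> nat \<Rightarrow> ('z + 'z) mpoly" where
  "certificate_poly h d r =
    (let v = (\<lambda>i. Var (Inl i)); w = (\<lambda>i. Var (Inr i))
     in (mpoly_subst (\<lambda>i. (v i)^2 - (w i)^2) h
          - Const (1 / real r) * (\<Sum>i\<in>UNIV. ((v i)^2 - (w i)^2)^2)^(2*d)
          + Const (1 / (2 * real r)) * (\<Sum>i\<in>UNIV. (v i)^4 + (w i)^4)^(2*d))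
        * ((\<Sum>i\<in>UNIV. (v i)^2) + (\<Sum>i\<in>UNIV. (w i)^2))^(r^2))"

end

theory Submission
  imports Defs
begin

text \<open>
  Positivity of \<open>p\<close> on \<open>S\<close> says that the system \<open>g\<^sub>i \<ge> 0, - p \<ge> 0\<close> has no solution. With slack
  variables it becomes a system of equations, \<open>g\<^sub>i(x) = s\<^sub>i\<^sup>2\<close> and \<open>- p(x) = s\<^sub>0\<^sup>2\<close>. On every
  solution the squares of all \<open>x\<^sub>i\<close> and \<open>s\<^sub>i\<close> add up to at most \<open>K = R + \<Sum>\<eta>\<^sub>i + \<beta>\<close>, and one
  further slack variable turns this bound into an equation as well. The form \<open>h\<close> is the sum of the
  squares of the homogenized equations. Its zeros with \<open>y \<noteq> 0\<close> dehomogenize to solutions of the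
  system, and the homogenized bound leaves no nontrivial zero with \<open>y = 0\<close>. Hence \<open>p > 0\<close> on \<open>S\<close>
  if and only if \<open>h\<close> is positive definite (\<open>positive_definite_h_form_iff\<close>).

  The rest holds for every form \<open>h\<close> of degree \<open>4d\<close>. The certificate polynomial is even in each
  variable: it arises by substituting \<open>v\<^sub>i\<^sup>2\<close> and \<open>w\<^sub>i\<^sup>2\<close> for \<open>a\<^sub>i\<close> and \<open>b\<^sub>i\<close> in \<open>(\<Sum>a\<^sub>i + \<Sum>b\<^sub>i)\<close> to the
  power \<open>r\<^sup>2\<close> times a form \<open>G\<^sub>r(a, b)\<close>. This form is \<open>h(a - b)\<close>, minus \<open>1/r\<close> times the \<open>4d\<close>-th
  power of the norm of \<open>a - b\<close>, plus \<open>1/(2r)\<close> times the \<open>4d\<close>-th power of the norm of \<open>(a, b)\<close>.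
  If all coefficients are nonnegative, then \<open>G\<^sub>r \<ge> 0\<close> at the positive and negative parts
  \<open>a = z\<^sup>+, b = z\<^sup>-\<close> of a point \<open>z\<close>. There \<open>a - b = z\<close> and \<open>(a, b)\<close> has the norm of \<open>z\<close>, so
  \<open>h(z)\<close> is at least \<open>1/(2r)\<close> times the \<open>4d\<close>-th power of that norm
  (\<open>positive_definite_of_certificate\<close>).

  Conversely, a positive definite \<open>h\<close> dominates a positive multiple of the \<open>4d\<close>-th power of the
  norm, by compactness of the sphere. For large \<open>r\<close> the first two terms of \<open>G\<^sub>r\<close> are then jointly
  nonnegative, so on the standard simplex \<open>G\<^sub>r\<close> is at least a constant times \<open>1/r\<close>, while its
  coefficients stay bounded. Polya's theorem says that multiplying a form that is positive on the
  simplex by a high power of the sum of the variables yields nonnegative coefficients, and the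
  quantitative version \<open>polya_bound\<close> shows that an exponent proportional to the size of the
  coefficients divided by the minimum suffices. This exponent grows only linearly in \<open>r\<close>, so
  \<open>r\<^sup>2\<close> is eventually enough (\<open>certificate_of_positive_definite\<close>).
\<close>

abbreviation keys :: "('a \<Rightarrow>\<^sub>0 'b::zero) \<Rightarrow> 'a set" where
  "keys \<equiv> Poly_Mapping.keys"

abbreviation lookup :: "('a \<Rightarrow>\<^sub>0 'b::zero) \<Rightarrow> 'a \<Rightarrow> 'b" where
  "lookup \<equiv> Poly_Mapping.lookup"

abbreviation single :: "'a \<Rightarrow> 'b::zero \<Rightarrow> 'a \<Rightarrow>\<^sub>0 'b" where
  "single \<equiv> Poly_Mapping.single"

section \<open>Monomials\<close>

definition mon_val :: "('v::finite \<Rightarrow> 'r::comm_semiring_1) \<Rightarrow> ('v \<Rightarrow>\<^sub>0 nat) \<Rightarrow> 'r" where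
  "mon_val f m = (\<Prod>i\<in>UNIV. f i ^ lookup m i)"

lemma prod_keys_eq_mon_val: "(\<Prod>i\<in>keys m. f i ^ lookup m i) = mon_val f m"
  unfolding mon_val_def by (rule prod.mono_neutral_left) (auto simp: in_keys_iff)

lemma mon_val_zero [simp]: "mon_val f 0 = 1"
  by (simp add: mon_val_def)

lemma mon_val_add: "mon_val f (m + m') = mon_val f m * mon_val f m'"
  by (simp add: mon_val_def lookup_add power_add prod.distrib)

lemma mon_val_single [simp]: "mon_val f (single i k) = f i ^ k"
proof -
  have "mon_val f (single i k) = (\<Prod>j\<in>{i}. f j ^ lookup (single i k) j)"
    unfolding mon_val_def by (rule prod.mono_neutral_right) (auto simp: lookup_single)
  then show ?thesis by simp
qed

lemma mon_degree_eq_sum_UNIV: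
  fixes m :: "'v::finite \<Rightarrow>\<^sub>0 nat"
  shows "mon_degree m = (\<Sum>i\<in>UNIV. lookup m i)"
  unfolding mon_degree_def by (rule sum.mono_neutral_left) (auto simp: in_keys_iff)

lemma mon_degree_add:
  fixes m m' :: "'v::finite \<Rightarrow>\<^sub>0 nat"
  shows "mon_degree (m + m') = mon_degree m + mon_degree m'"
  by (simp add: mon_degree_eq_sum_UNIV lookup_add sum.distrib)

lemma mon_degree_zero [simp]: "mon_degree 0 = 0"
  by (simp add: mon_degree_def)

lemma mon_degree_single [simp]: "mon_degree (single i k) = k"
  by (auto simp: mon_degree_def)

lemma mpoly_expand:
  fixes q :: "'v mpoly"
  shows "q = (\<Sum>m\<in>keys q. single m (lookup q m))"
proof (rule poly_mapping_eqI)
  fix k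
  have "(\<Sum>m\<in>keys q. lookup (single m (lookup q m)) k) = (\<Sum>m\<in>keys q. if k = m then lookup q m else 0)"
    by (rule sum.cong) (auto simp: lookup_single when_def)
  then show "lookup q k = lookup (\<Sum>m\<in>keys q. single m (lookup q m)) k"
    by (simp add: lookup_sum sum.delta in_keys_iff)
qed

lemma mpoly_mult_expand:
  fixes p q :: "'v mpoly"
  shows "p * q = (\<Sum>m\<in>keys p. \<Sum>m'\<in>keys q. single (m + m') (lookup p m * lookup q m'))"
  by (subst (1) mpoly_expand[of p], subst (1) mpoly_expand[of q])
     (simp add: sum_product mult_single)

section \<open>Evaluation and substitution are ring homomorphisms\<close>

text \<open>
  Evaluating at real numbers and substituting polynomials are the same construction, differing only
  in the ring in which the values lie. The locale takes the map \<open>c\<close> from real coefficients to that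
  ring as its parameter, so that the homomorphism laws are proved once for both.
\<close>

locale coeff_hom =
  fixes c :: "real \<Rightarrow> 'r::comm_ring_1"
  assumes hom_one: "c 1 = 1"
    and hom_add: "c (a + b) = c a + c b"
    and hom_mult: "c (a * b) = c a * c b"
begin

lemma hom_zero: "c 0 = 0"
  using hom_add[of 0 0] by simp

definition ev :: "('v::finite \<Rightarrow> 'r) \<Rightarrow> 'v mpoly \<Rightarrow> 'r" where
  "ev f q = (\<Sum>m\<in>keys q. c (lookup q m) * mon_val f m)"

lemma ev_superset: "finite A \<Longrightarrow> keys q \<subseteq> A \<Longrightarrow> ev f q = (\<Sum>m\<in>A. c (lookup q m) * mon_val f m)"
  unfolding ev_def by (rule sum.mono_neutral_left) (auto simp: in_keys_iff hom_zero)

lemma ev_zero [simp]: "ev f 0 = 0"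
  by (simp add: ev_def)

lemma ev_add: "ev f (p + q) = ev f p + ev f q"
  using keys_add[of p q]
  by (simp add: ev_superset[of "keys p \<union> keys q"] lookup_add hom_add algebra_simps sum.distrib)

lemma ev_sum: "ev f (sum P A) = (\<Sum>a\<in>A. ev f (P a))"
  by (induction A rule: infinite_finite_induct) (simp_all add: ev_add)

lemma ev_single: "ev f (single m a) = c a * mon_val f m"
  by (subst ev_superset[of "{m}"]) auto

lemma ev_mult: "ev f (p * q) = ev f p * ev f q"
  unfolding mpoly_mult_expand[of p q]
  by (simp add: ev_sum ev_single ev_def[of f p] ev_def[of f q] sum_product hom_mult mon_val_add mult_ac)

lemma ev_Const: "ev f (Const a) = c a"
  by (simp add: Const_def ev_single)

lemma ev_Var: "ev f (Var i) = f i"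
  by (simp add: Var_def ev_single hom_one)

lemma ev_one: "ev f 1 = 1"
  using ev_Const[of f 1] by (simp add: hom_one Const_def)

lemma ev_diff: "ev f (p - q) = ev f p - ev f q"
  using ev_add[of f "p - q" q] by (simp add: algebra_simps)

lemma ev_power: "ev f (p ^ k) = ev f p ^ k"
  by (induction k) (simp_all add: ev_one ev_mult)

lemma ev_prod: "ev f (prod P A) = (\<Prod>a\<in>A. ev f (P a))"
  by (induction A rule: infinite_finite_induct) (simp_all add: ev_one ev_mult)

lemmas ev_simps = ev_add ev_sum ev_mult ev_Const ev_Var ev_diff ev_power ev_prod

lemma ev_mpoly_subst: "ev f (mpoly_subst u q) = ev (\<lambda>i. ev f (u i)) q"
  unfolding mpoly_subst_def prod_keys_eq_mon_val mpoly_coeff_def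
  by (simp add: ev_simps mon_val_def ev_def[of _ q])

end

interpretation eval: coeff_hom "\<lambda>a::real. a"
  rewrites "coeff_hom.ev (\<lambda>a::real. a) = mpoly_eval"
proof -
  show *: "coeff_hom (\<lambda>a::real. a)" by unfold_locales auto
  show "coeff_hom.ev (\<lambda>a::real. a) = mpoly_eval"
    by (intro ext) (simp add: coeff_hom.ev_def[OF *] mpoly_eval_def mpoly_coeff_def prod_keys_eq_mon_val)
qed

interpretation subst: coeff_hom "Const :: real \<Rightarrow> 'w mpoly"
  rewrites "coeff_hom.ev (Const :: real \<Rightarrow> 'w mpoly) = mpoly_subst"
proof -
  show *: "coeff_hom (Const :: real \<Rightarrow> 'w mpoly)"
    by unfold_locales (auto simp: Const_def single_add mult_single)
  show "coeff_hom.ev (Const :: real \<Rightarrow> 'w mpoly) = mpoly_subst"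
    by (intro ext) (simp add: coeff_hom.ev_def[OF *] mpoly_subst_def mpoly_coeff_def prod_keys_eq_mon_val)
qed

lemma eval_homogenization:
  fixes q :: "'v::finite mpoly" and y :: "'w::finite mpoly"
  assumes deg: "\<And>m. m \<in> keys q \<Longrightarrow> mon_degree m \<le> k" and y: "mpoly_eval a y \<noteq> 0"
  shows "mpoly_eval a (homogenization k f y q)
    = mpoly_eval a y ^ k * mpoly_eval (\<lambda>i. mpoly_eval a (f i) / mpoly_eval a y) q"
proof -
  let ?y = "mpoly_eval a y"
  have "mpoly_eval a (homogenization k f y q)
      = (\<Sum>m\<in>keys q. lookup q m * mon_val (\<lambda>i. mpoly_eval a (f i)) m * ?y ^ (k - mon_degree m))"
    by (simp add: homogenization_def prod_keys_eq_mon_val mon_val_def eval.ev_simps mpoly_coeff_def)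
  also have "\<dots> = (\<Sum>m\<in>keys q. ?y ^ k * (lookup q m * mon_val (\<lambda>i. mpoly_eval a (f i) / ?y) m))"
  proof (rule sum.cong)
    fix m assume m: "m \<in> keys q"
    have "mon_val (\<lambda>i. mpoly_eval a (f i) / ?y) m = mon_val (\<lambda>i. mpoly_eval a (f i)) m / ?y ^ mon_degree m"
      by (simp add: mon_val_def power_divide prod_dividef mon_degree_eq_sum_UNIV power_sum)
    then show "lookup q m * mon_val (\<lambda>i. mpoly_eval a (f i)) m * ?y ^ (k - mon_degree m)
       = ?y ^ k * (lookup q m * mon_val (\<lambda>i. mpoly_eval a (f i) / ?y) m)"
      using deg[OF m] y by (simp add: power_diff)
  qed simp
  also have "\<dots> = ?y ^ k * mpoly_eval (\<lambda>i. mpoly_eval a (f i) / ?y) q"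
    by (simp add: eval.ev_def sum_distrib_left)
  finally show ?thesis .
qed

section \<open>Forms\<close>

definition is_form :: "nat \<Rightarrow> 'v mpoly \<Rightarrow> bool" where
  "is_form k q \<longleftrightarrow> (\<forall>m\<in>keys q. mon_degree m = k)"

lemma is_form_zero: "is_form k 0"
  by (simp add: is_form_def)

lemma is_form_add: "is_form k p \<Longrightarrow> is_form k q \<Longrightarrow> is_form k (p + q)"
  using keys_add[of p q] by (auto simp: is_form_def)

lemma is_form_uminus: "is_form k (- p) \<longleftrightarrow> is_form k p"
  by (simp add: is_form_def in_keys_iff)

lemma is_form_diff: "is_form k p \<Longrightarrow> is_form k q \<Longrightarrow> is_form k (p - q)"
  using is_form_add[of k p "- q"] by (simp add: is_form_uminus)

lemma is_form_sum: "(\<And>a. a \<in> A \<Longrightarrow> is_form k (P a)) \<Longrightarrow> is_form k (sum P A)"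
  by (induction A rule: infinite_finite_induct) (auto simp: is_form_zero is_form_add)

lemma is_form_mult:
  fixes p q :: "'v::finite mpoly"
  shows "is_form k p \<Longrightarrow> is_form l q \<Longrightarrow> is_form (k + l) (p * q)"
  using keys_mult[of p q] by (fastforce simp: is_form_def mon_degree_add)

lemma is_form_Const: "is_form 0 (Const a)"
  by (simp add: is_form_def Const_def)

lemma is_form_one: "is_form 0 1"
  by (simp add: is_form_def)

lemma is_form_Var: "is_form 1 (Var i)"
  by (simp add: is_form_def Var_def)

lemma is_form_power:
  fixes p :: "'v::finite mpoly"
  shows "is_form k p \<Longrightarrow> is_form (l * k) (p ^ l)"
  by (induction l) (auto simp: is_form_one is_form_mult)

lemma is_form_prod:
  fixes P :: "'a \<Rightarrow> 'v::finite mpoly"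
  shows "(\<And>a. a \<in> A \<Longrightarrow> is_form (k a) (P a)) \<Longrightarrow> is_form (sum k A) (prod P A)"
  by (induction A rule: infinite_finite_induct) (auto simp: is_form_one is_form_mult)

lemma is_form_mon_val:
  fixes f :: "'v::finite \<Rightarrow> 'w::finite mpoly"
  assumes "\<And>i. is_form 1 (f i)"
  shows "is_form (mon_degree m) (mon_val f m)"
  unfolding mon_val_def mon_degree_eq_sum_UNIV
  using is_form_power[OF assms] by (intro is_form_prod) auto

lemma is_form_subst:
  fixes f :: "'v::finite \<Rightarrow> 'w::finite mpoly"
  assumes "\<And>i. is_form 1 (f i)" "is_form k q"
  shows "is_form k (mpoly_subst f q)"
  unfolding subst.ev_def
proof (rule is_form_sum)
  fix m assume "m \<in> keys q"
  then show "is_form k (Const (lookup q m) * mon_val f m)"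
    using is_form_mult[OF is_form_Const is_form_mon_val[OF assms(1), of m], of "lookup q m"] assms(2)
    by (simp add: is_form_def)
qed

lemma is_form_homogenization:
  fixes f :: "'v::finite \<Rightarrow> 'w::finite mpoly"
  assumes "\<And>i. is_form 1 (f i)" "is_form 1 y" and deg: "\<And>m. m \<in> keys q \<Longrightarrow> mon_degree m \<le> k"
  shows "is_form k (homogenization k f y q)"
  unfolding homogenization_def prod_keys_eq_mon_val
proof (rule is_form_sum)
  fix m assume m: "m \<in> keys q"
  have "is_form (0 + mon_degree m + (k - mon_degree m) * 1)
      (Const (mpoly_coeff q m) * mon_val f m * y ^ (k - mon_degree m))"
    using assms(1,2) by (intro is_form_mult is_form_Const is_form_mon_val is_form_power)
  then show "is_form k (Const (mpoly_coeff q m) * mon_val f m * y ^ (k - mon_degree m))"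
    using deg[OF m] by simp
qed

lemma eval_form_scale:
  fixes q :: "'v::finite mpoly"
  assumes "is_form k q"
  shows "mpoly_eval (\<lambda>i. t * a i) q = t ^ k * mpoly_eval a q"
  using assms
  by (auto simp: eval.ev_def is_form_def mon_val_def power_mult_distrib prod.distrib
      power_sum[symmetric] mon_degree_eq_sum_UNIV[symmetric] sum_distrib_left intro!: sum.cong)

section \<open>Polya's theorem with a bound\<close>

lemma lookup_single_mult_add:
  fixes q :: "'v mpoly"
  shows "lookup (single e a * q) (e + m) = a * lookup q m"
proof -
  have "single e a * q = (\<Sum>k\<in>keys q. single (e + k) (a * lookup q k))"
    by (subst mpoly_expand[of q]) (simp add: sum_distrib_left mult_single)
  then have "lookup (single e a * q) (e + m) = (\<Sum>k\<in>keys q. if m = k then a * lookup q k else 0)"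
    by (simp add: lookup_sum lookup_single when_def)
  then show ?thesis by (simp add: in_keys_iff)
qed

lemma lookup_Var_mult:
  fixes q :: "'v mpoly"
  shows "lookup (Var i * q) m = (if lookup m i = 0 then 0 else lookup q (m - single i 1))"
proof (cases "lookup m i = 0")
  case True
  have "m \<notin> keys (Var i * q)"
  proof
    assume "m \<in> keys (Var i * q)"
    then obtain k where "m = single i 1 + k"
      using keys_mult[of "Var i" q] by (auto simp: Var_def)
    then show False using True by (simp add: lookup_add)
  qed
  then show ?thesis using True by (simp add: in_keys_iff)
next
  case False
  have "m = single i 1 + (m - single i 1)"
    using False by (intro poly_mapping_eqI) (auto simp: lookup_add lookup_minus lookup_single when_def)
  then show ?thesis
    using False lookup_single_mult_add[of "single i 1" 1 q "m - single i 1"] by (simp add: Var_def)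
qed

text \<open>
  The product over \<open>i\<close> of the falling factorials \<open>m\<^sub>i (m\<^sub>i - 1) \<cdots> (m\<^sub>i - \<alpha>\<^sub>i + 1)\<close>, the discrete counterpart of
  the value of the monomial \<open>\<alpha>\<close> at the point \<open>m\<close>.
\<close>

definition falling :: "('v::finite \<Rightarrow>\<^sub>0 nat) \<Rightarrow> ('v \<Rightarrow>\<^sub>0 nat) \<Rightarrow> real" where
  "falling m \<alpha> = (\<Prod>i\<in>UNIV. \<Prod>j<lookup \<alpha> i. real (lookup m i) - real j)"

lemma falling_eq_zero: "lookup m i < lookup \<alpha> i \<Longrightarrow> falling m \<alpha> = 0"
  unfolding falling_def by (intro prod_zero bexI[of _ i]) (auto intro: bexI[of _ "lookup m i"])

lemma falling_self: "falling m m = (\<Prod>i\<in>UNIV. fact (lookup m i))"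
proof -
  have "(\<Prod>j<k. real k - real j) = fact k" for k
  proof -
    have "(\<Prod>j<k. real k - real j) = (\<Prod>j<k. real (Suc j))"
      by (subst prod.nat_diff_reindex[symmetric]) (auto intro!: prod.cong simp: of_nat_diff)
    also have "\<dots> = fact k"
      by (induction k) (simp_all add: algebra_simps)
    finally show ?thesis .
  qed
  then show ?thesis by (simp add: falling_def)
qed

lemma mon_degree_eq_imp_less:
  fixes m \<alpha> :: "'v::finite \<Rightarrow>\<^sub>0 nat"
  assumes "mon_degree m = mon_degree \<alpha>" "m \<noteq> \<alpha>"
  shows "\<exists>i. lookup m i < lookup \<alpha> i"
proof (rule ccontr)
  assume *: "\<not> ?thesis"
  obtain j where "lookup \<alpha> j \<noteq> lookup m j"
    using assms(2) by (metis poly_mapping_eqI)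
  then have "(\<Sum>i\<in>UNIV. lookup \<alpha> i) < (\<Sum>i\<in>UNIV. lookup m i)"
    using * by (intro sum_strict_mono_ex1) (auto simp: not_less, metis le_neq_implies_less)
  then show False using assms(1) by (simp add: mon_degree_eq_sum_UNIV)
qed

text \<open>
  In the variable \<open>i\<close>, both sides are the falling factorial of length \<open>\<alpha>\<^sub>i + 1\<close>, with its first or its
  last factor split off.
\<close>

lemma falling_minus_single:
  fixes m \<alpha> :: "'v::finite \<Rightarrow>\<^sub>0 nat"
  assumes "lookup m i \<noteq> 0"
  shows "real (lookup m i) * falling (m - single i 1) \<alpha>
    = falling m \<alpha> * (real (lookup m i) - real (lookup \<alpha> i))"
proof -
  have one: "x * (\<Prod>j<k. x - 1 - real j) = (\<Prod>j<k. x - real j) * (x - real k)" for x :: real and k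
  proof -
    have "(\<Prod>j<k. x - real j) * (x - real k) = (\<Prod>j<Suc k. x - real j)" by simp
    also have "\<dots> = x * (\<Prod>j<k. x - 1 - real j)"
      by (subst prod.lessThan_Suc_shift) (simp add: algebra_simps)
    finally show ?thesis by simp
  qed
  have split: "(\<Prod>k\<in>UNIV. F k) = F i * (\<Prod>k\<in>UNIV - {i}. F k)" for F :: "'v \<Rightarrow> real"
    by (simp add: prod.remove)
  have "real (lookup m i) * (\<Prod>j<lookup \<alpha> i. real (lookup (m - single i 1) i) - real j)
      = (\<Prod>j<lookup \<alpha> i. real (lookup m i) - real j) * (real (lookup m i) - real (lookup \<alpha> i))"
    using assms one[of "real (lookup m i)" "lookup \<alpha> i"] by (simp add: lookup_minus of_nat_diff)
  moreover have "(\<Prod>k\<in>UNIV - {i}. \<Prod>j<lookup \<alpha> k. real (lookup (m - single i 1) k) - real j)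
     = (\<Prod>k\<in>UNIV - {i}. \<Prod>j<lookup \<alpha> k. real (lookup m k) - real j)"
    by (intro prod.cong) (auto simp: lookup_minus lookup_single)
  ultimately show ?thesis
    unfolding falling_def split by simp
qed

lemma prod_fact_minus_single:
  fixes m :: "'v::finite \<Rightarrow>\<^sub>0 nat"
  assumes "lookup m i \<noteq> 0"
  shows "(\<Prod>k\<in>UNIV. fact (lookup m k) :: real)
    = real (lookup m i) * (\<Prod>k\<in>UNIV. fact (lookup (m - single i 1) k))"
proof -
  have "(\<Prod>k\<in>UNIV - {i}. fact (lookup (m - single i 1) k) :: real) = (\<Prod>k\<in>UNIV - {i}. fact (lookup m k))"
    by (intro prod.cong) (auto simp: lookup_minus lookup_single)
  moreover have "(fact (lookup m i) :: real) = real (lookup m i) * fact (lookup (m - single i 1) i)"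
    using assms by (simp add: lookup_minus fact_reduce)
  ultimately show ?thesis
    by (simp add: prod.remove[of UNIV i])
qed

text \<open>
  The power of the sum of the variables has multinomial coefficients. If \<open>\<alpha> \<le> m\<close>, then the monomial
  \<open>\<alpha>\<close> of \<open>G\<close> contributes to the coefficient of \<open>m\<close> the multinomial coefficient of \<open>m - \<alpha>\<close>, which is
  \<open>N! / m!\<close> times a product of falling factorials; otherwise that product vanishes. Induction on
  \<open>N\<close> replaces the multinomial theorem: multiplying by a variable shifts \<open>m\<close> by one, and
  the resulting factors \<open>m\<^sub>i - \<alpha>\<^sub>i\<close> add up to the new exponent \<open>N + 1\<close>.
\<close>

lemma lookup_polya_product:
  fixes G :: "'v::finite mpoly"
  assumes G: "is_form D G" and m: "mon_degree m = N + D"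
  shows "lookup ((\<Sum>i\<in>UNIV. Var i) ^ N * G) m
    = fact N / (\<Prod>i\<in>UNIV. fact (lookup m i)) * (\<Sum>\<alpha>\<in>keys G. lookup G \<alpha> * falling m \<alpha>)"
  using m
proof (induction N arbitrary: m)
  case 0
  have "(\<Sum>\<alpha>\<in>keys G. lookup G \<alpha> * falling m \<alpha>)
      = (\<Sum>\<alpha>\<in>keys G. if m = \<alpha> then lookup G \<alpha> * falling m m else 0)"
  proof (rule sum.cong)
    fix \<alpha> assume "\<alpha> \<in> keys G"
    then have "mon_degree m = mon_degree \<alpha>"
      using G 0 by (simp add: is_form_def)
    then show "lookup G \<alpha> * falling m \<alpha> = (if m = \<alpha> then lookup G \<alpha> * falling m m else 0)"
      using mon_degree_eq_imp_less[of m \<alpha>] falling_eq_zero by fastforce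
  qed simp
  also have "\<dots> = lookup G m * falling m m"
    by (simp add: in_keys_iff)
  finally show ?case
    by (simp add: falling_self)
next
  case (Suc N)
  let ?F = "\<Prod>i\<in>UNIV. fact (lookup m i) :: real"
  let ?Q = "(\<Sum>i\<in>UNIV. Var i) ^ N * G"
  have summand: "lookup (Var i * ?Q) m = fact N / ?F *
      (\<Sum>\<alpha>\<in>keys G. lookup G \<alpha> * (falling m \<alpha> * (real (lookup m i) - real (lookup \<alpha> i))))" for i
  proof (cases "lookup m i = 0")
    case True
    have "falling m \<alpha> * (real (lookup m i) - real (lookup \<alpha> i)) = 0" for \<alpha>
      using True falling_eq_zero[of m i \<alpha>] by (cases "lookup \<alpha> i = 0") auto
    then have "(\<Sum>\<alpha>\<in>keys G. lookup G \<alpha> * (falling m \<alpha> * (real (lookup m i) - real (lookup \<alpha> i)))) = 0"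
      by (intro sum.neutral) (simp only: mult_zero_right, blast)
    then show ?thesis using True by (simp only: lookup_Var_mult) simp
  next
    case False
    let ?m = "m - single i 1"
    have eq: "m = single i 1 + ?m"
      using False by (intro poly_mapping_eqI) (auto simp: lookup_add lookup_minus lookup_single when_def)
    have "mon_degree m = 1 + mon_degree ?m"
      using mon_degree_add[of "single i 1" ?m] eq by simp
    then have deg: "mon_degree ?m = N + D"
      using Suc.prems by simp
    have "lookup (Var i * ?Q) m
        = fact N / (\<Prod>k\<in>UNIV. fact (lookup ?m k)) * (\<Sum>\<alpha>\<in>keys G. lookup G \<alpha> * falling ?m \<alpha>)"
      using False Suc.IH[OF deg] by (simp add: lookup_Var_mult)
    also have "\<dots> = fact N / ?F * (\<Sum>\<alpha>\<in>keys G. lookup G \<alpha> * (real (lookup m i) * falling ?m \<alpha>))"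
      using False
      by (simp add: prod_fact_minus_single[OF False] sum_distrib_left mult_ac)
    finally show ?thesis
      by (simp only: falling_minus_single[OF False])
  qed
  have sum_diff: "(\<Sum>i\<in>UNIV. real (lookup m i) - real (lookup \<alpha> i)) = real (Suc N)" if "\<alpha> \<in> keys G" for \<alpha>
  proof -
    have "mon_degree \<alpha> = D"
      using G that by (simp add: is_form_def)
    with Suc.prems have "(\<Sum>i\<in>UNIV. lookup m i) = Suc N + (\<Sum>i\<in>UNIV. lookup \<alpha> i)"
      by (simp add: mon_degree_eq_sum_UNIV)
    then show ?thesis
      by (simp add: sum_subtractf flip: of_nat_sum)
  qed
  have "(\<Sum>i\<in>UNIV. Var i) ^ Suc N * G = (\<Sum>i\<in>UNIV. Var i * ?Q)"
    by (simp add: sum_distrib_right mult.assoc)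
  then have "lookup ((\<Sum>i\<in>UNIV. Var i) ^ Suc N * G) m = (\<Sum>i\<in>UNIV. lookup (Var i * ?Q) m)"
    by (simp only: lookup_sum)
  also have "\<dots> = fact N / ?F * (\<Sum>i\<in>UNIV. \<Sum>\<alpha>\<in>keys G.
      lookup G \<alpha> * (falling m \<alpha> * (real (lookup m i) - real (lookup \<alpha> i))))"
    by (simp only: summand sum_distrib_left)
  also have "\<dots> = fact N / ?F * (\<Sum>\<alpha>\<in>keys G. \<Sum>i\<in>UNIV.
      lookup G \<alpha> * (falling m \<alpha> * (real (lookup m i) - real (lookup \<alpha> i))))"
    by (subst sum.swap) simp
  also have "\<dots> = fact N / ?F * (\<Sum>\<alpha>\<in>keys G. lookup G \<alpha> * (falling m \<alpha> * real (Suc N)))"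
    using sum_diff by (simp only: sum_distrib_left[symmetric] cong: sum.cong)
  also have "\<dots> = fact (Suc N) / ?F * (\<Sum>\<alpha>\<in>keys G. lookup G \<alpha> * falling m \<alpha>)"
    by (simp only: sum_distrib_left fact_Suc) (simp add: mult_ac sum_distrib_left)
  finally show ?case .
qed

definition coeff_norm :: "'v mpoly \<Rightarrow> real" where
  "coeff_norm q = (\<Sum>m\<in>keys q. \<bar>lookup q m\<bar>)"

lemma coeff_norm_superset: "finite A \<Longrightarrow> keys q \<subseteq> A \<Longrightarrow> coeff_norm q = (\<Sum>m\<in>A. \<bar>lookup q m\<bar>)"
  unfolding coeff_norm_def by (rule sum.mono_neutral_left) (auto simp: in_keys_iff)

lemma coeff_norm_add_le: "coeff_norm (p + q) \<le> coeff_norm p + coeff_norm q"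
  using keys_add[of p q]
  by (simp add: coeff_norm_superset[of "keys p \<union> keys q"] lookup_add sum.distrib[symmetric] sum_mono)

lemma coeff_norm_Const_mult: "coeff_norm (Const a * q) \<le> \<bar>a\<bar> * coeff_norm q"
proof -
  have eq: "lookup (Const a * q) m = a * lookup q m" for m
    using lookup_single_mult_add[of 0 a q m] by (simp add: Const_def)
  then have "keys (Const a * q) \<subseteq> keys q"
    by (auto simp: in_keys_iff)
  then show ?thesis
    by (simp add: coeff_norm_superset[of "keys q"] eq abs_mult sum_distrib_left)
qed

text \<open>
  After division by \<open>n\<close> to the power \<open>D\<close>, the falling factorials become a product of \<open>D\<close> factors
  \<open>m\<^sub>i/n - j/n\<close> with \<open>j < D\<close>. All these factors lie in \<open>[-1, 1]\<close>, so dropping the \<open>D\<close> shifts \<open>j/n\<close>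
  changes the product by at most \<open>D\<close> times \<open>D/n\<close>.
\<close>

lemma falling_approx:
  fixes m \<alpha> :: "'v::finite \<Rightarrow>\<^sub>0 nat"
  assumes n: "0 < n" "mon_degree m = n" and \<alpha>: "mon_degree \<alpha> = D" and "D \<le> n"
  shows "\<bar>falling m \<alpha> / real n ^ D - mon_val (\<lambda>i. real (lookup m i) / real n) \<alpha>\<bar> \<le> real D ^ 2 / real n"
proof -
  define x where "x i = real (lookup m i) / real n" for i
  \<comment> \<open>One index pair for each of the \<open>D\<close> factors of the falling factorials.\<close>
  define I where "I = (SIGMA i:UNIV. {..<lookup \<alpha> i})"
  have card: "card I = D"
    using \<alpha> by (simp add: I_def mon_degree_eq_sum_UNIV)
  have fin: "finite I" by (simp add: I_def)
  have j_less: "j < D" if "(i, j) \<in> I" for i j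
  proof -
    have "lookup \<alpha> i \<le> D"
      using \<alpha> member_le_sum[of i UNIV "lookup \<alpha>"] by (simp add: mon_degree_eq_sum_UNIV)
    then show ?thesis using that by (simp add: I_def)
  qed
  have x: "0 \<le> x i" "x i \<le> 1" for i
    using n member_le_sum[of i UNIV "lookup m"]
    by (auto simp: x_def mon_degree_eq_sum_UNIV divide_simps)
  have "falling m \<alpha> = (\<Prod>(i, j)\<in>I. real (lookup m i) - real j)"
    unfolding falling_def I_def by (rule prod.Sigma) auto
  also have "\<dots> = (\<Prod>(i, j)\<in>I. real n * (x i - real j / real n))"
    using n(1) by (intro prod.cong) (auto simp: x_def field_simps)
  also have "\<dots> = real n ^ D * (\<Prod>(i, j)\<in>I. x i - real j / real n)"
    by (simp add: prod.distrib case_prod_unfold card)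
  finally have 1: "falling m \<alpha> / real n ^ D = (\<Prod>z\<in>I. x (fst z) - real (snd z) / real n)"
    using n(1) by (simp add: case_prod_unfold)
  have "mon_val x \<alpha> = (\<Prod>i\<in>UNIV. \<Prod>j<lookup \<alpha> i. x i)"
    by (simp add: mon_val_def)
  also have "\<dots> = (\<Prod>z\<in>I. x (fst z))"
    unfolding I_def by (subst prod.Sigma) (auto simp: case_prod_unfold)
  finally have 2: "mon_val x \<alpha> = (\<Prod>z\<in>I. x (fst z))" .
  have frac: "0 \<le> real (snd z) / real n" "real (snd z) / real n \<le> real D / real n" "real D / real n \<le> 1"
    if "z \<in> I" for z
    using j_less[of "fst z" "snd z"] that n(1) \<open>D \<le> n\<close> by (auto simp: divide_simps)
  have "\<bar>falling m \<alpha> / real n ^ D - mon_val x \<alpha>\<bar>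
      = norm ((\<Prod>z\<in>I. x (fst z) - real (snd z) / real n) - (\<Prod>z\<in>I. x (fst z)))"
    by (simp only: 1 2 real_norm_def)
  also have "\<dots> \<le> (\<Sum>z\<in>I. norm (x (fst z) - real (snd z) / real n - x (fst z)))"
  proof (rule norm_prod_diff)
    fix z assume z: "z \<in> I"
    show "norm (x (fst z) - real (snd z) / real n) \<le> 1"
      using frac[OF z] x[of "fst z"] unfolding real_norm_def abs_le_iff by linarith
    show "norm (x (fst z)) \<le> 1" using x[of "fst z"] by simp
  qed
  also have "\<dots> \<le> (\<Sum>z\<in>I. real D / real n)"
    using frac by (intro sum_mono) auto
  also have "\<dots> = real D ^ 2 / real n"
    by (simp add: card power2_eq_square)
  finally show ?thesis by (simp add: x_def[abs_def])
qed

definition nonneg_coeffs :: "'v mpoly \<Rightarrow> bool" where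
  "nonneg_coeffs q \<longleftrightarrow> (\<forall>m. 0 \<le> lookup q m)"

text \<open>
  Up to a positive factor, the coefficient of \<open>m\<close> in the product is the value of \<open>G\<close> at the point
  \<open>m / (N + D)\<close> of the simplex, with powers replaced by falling factorials. The replacement changes
  the value by at most \<open>D\<^sup>2\<close> times the norm of the coefficients over \<open>N + D\<close>; the hypothesis
  on \<open>N\<close> says that this error does not exceed the lower bound \<open>\<mu>\<close>.
\<close>

lemma polya_bound:
  fixes G :: "'v::finite mpoly"
  assumes G: "is_form D G"
    and pos: "\<And>x. (\<And>i. 0 \<le> x i) \<Longrightarrow> (\<Sum>i\<in>UNIV. x i) = 1 \<Longrightarrow> \<mu> \<le> mpoly_eval x G"
    and N: "0 < N" "real D ^ 2 * coeff_norm G \<le> \<mu> * real (N + D)"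
  shows "nonneg_coeffs ((\<Sum>i\<in>UNIV. Var i) ^ N * G)"
  unfolding nonneg_coeffs_def
proof
  fix m :: "'v \<Rightarrow>\<^sub>0 nat"
  have form: "is_form (N * 1 + D) ((\<Sum>i\<in>UNIV. Var i) ^ N * G)"
    by (intro is_form_mult is_form_power is_form_sum is_form_Var G)
  show "0 \<le> lookup ((\<Sum>i\<in>UNIV. Var i) ^ N * G) m"
  proof (cases "mon_degree m = N + D")
    case False
    then have "m \<notin> keys ((\<Sum>i\<in>UNIV. Var i) ^ N * G)"
      using form by (auto simp: is_form_def)
    then show ?thesis by (simp add: in_keys_iff)
  next
    case True
    define n where "n = N + D"
    have n: "0 < n" "D \<le> n" "mon_degree m = n"
      using N(1) True by (auto simp: n_def)
    define x where "x i = real (lookup m i) / real n" for i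
    have "(\<Sum>i\<in>UNIV. x i) = real (mon_degree m) / real n"
      by (simp add: x_def mon_degree_eq_sum_UNIV sum_divide_distrib)
    then have lower: "\<mu> \<le> mpoly_eval x G"
      using n by (intro pos) (auto simp: x_def)
    have "\<bar>(\<Sum>\<alpha>\<in>keys G. lookup G \<alpha> * (falling m \<alpha> / real n ^ D)) - mpoly_eval x G\<bar>
        = \<bar>\<Sum>\<alpha>\<in>keys G. lookup G \<alpha> * (falling m \<alpha> / real n ^ D - mon_val x \<alpha>)\<bar>"
      by (simp add: eval.ev_def sum_subtractf algebra_simps)
    also have "\<dots> \<le> (\<Sum>\<alpha>\<in>keys G. \<bar>lookup G \<alpha> * (falling m \<alpha> / real n ^ D - mon_val x \<alpha>)\<bar>)"
      by (rule sum_abs)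
    also have "\<dots> \<le> (\<Sum>\<alpha>\<in>keys G. \<bar>lookup G \<alpha>\<bar> * (real D ^ 2 / real n))"
    proof (rule sum_mono)
      fix \<alpha> assume "\<alpha> \<in> keys G"
      then have "mon_degree \<alpha> = D" using G by (simp add: is_form_def)
      then show "\<bar>lookup G \<alpha> * (falling m \<alpha> / real n ^ D - mon_val x \<alpha>)\<bar> \<le> \<bar>lookup G \<alpha>\<bar> * (real D ^ 2 / real n)"
        using falling_approx[of n m \<alpha> D] n
        unfolding abs_mult x_def[abs_def] by (intro mult_left_mono) auto
    qed
    also have "\<dots> = real D ^ 2 * coeff_norm G / real n"
      by (simp add: coeff_norm_def sum_distrib_left sum_distrib_right mult_ac sum_divide_distrib)
    also have "\<dots> \<le> \<mu>"
      using N(2) n(1) unfolding n_def[symmetric] by (simp add: pos_divide_le_eq)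
    finally have "0 \<le> (\<Sum>\<alpha>\<in>keys G. lookup G \<alpha> * (falling m \<alpha> / real n ^ D))"
      using lower by linarith
    then have "0 \<le> (\<Sum>\<alpha>\<in>keys G. lookup G \<alpha> * falling m \<alpha>) / real n ^ D"
      by (simp add: sum_divide_distrib)
    then have "0 \<le> (\<Sum>\<alpha>\<in>keys G. lookup G \<alpha> * falling m \<alpha>)"
      using n(1) by (simp add: pos_le_divide_eq)
    then show ?thesis
      unfolding lookup_polya_product[OF G True]
      by (intro mult_nonneg_nonneg divide_nonneg_nonneg prod_nonneg) auto
  qed
qed

section \<open>Certificates for positive definite forms\<close>

lemma nonneg_coeffs_Const: "0 \<le> a \<Longrightarrow> nonneg_coeffs (Const a)"
  by (simp add: nonneg_coeffs_def Const_def lookup_single when_def)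

lemma nonneg_coeffs_Var: "nonneg_coeffs (Var i)"
  by (simp add: nonneg_coeffs_def Var_def lookup_single when_def)

lemma nonneg_coeffs_sum: "(\<And>a. a \<in> A \<Longrightarrow> nonneg_coeffs (P a)) \<Longrightarrow> nonneg_coeffs (sum P A)"
  by (simp add: nonneg_coeffs_def lookup_sum sum_nonneg)

lemma nonneg_coeffs_mult:
  fixes p q :: "'v mpoly"
  assumes "nonneg_coeffs p" "nonneg_coeffs q"
  shows "nonneg_coeffs (p * q)"
  unfolding mpoly_mult_expand[of p q]
  using assms by (intro nonneg_coeffs_sum) (simp add: nonneg_coeffs_def lookup_single when_def)

lemma nonneg_coeffs_one: "nonneg_coeffs 1"
  by (simp add: nonneg_coeffs_def lookup_one when_def)

lemma nonneg_coeffs_power: "nonneg_coeffs p \<Longrightarrow> nonneg_coeffs (p ^ k)"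
  by (induction k) (auto simp: nonneg_coeffs_one nonneg_coeffs_mult)

lemma nonneg_coeffs_prod: "(\<And>a. a \<in> A \<Longrightarrow> nonneg_coeffs (P a)) \<Longrightarrow> nonneg_coeffs (prod P A)"
  by (induction A rule: infinite_finite_induct) (auto simp: nonneg_coeffs_one nonneg_coeffs_mult)

lemma nonneg_coeffs_subst:
  fixes f :: "'v::finite \<Rightarrow> 'w::finite mpoly"
  assumes "\<And>i. nonneg_coeffs (f i)" "nonneg_coeffs q"
  shows "nonneg_coeffs (mpoly_subst f q)"
  unfolding subst.ev_def mon_val_def
  using assms(2)
  by (intro nonneg_coeffs_sum nonneg_coeffs_mult nonneg_coeffs_Const nonneg_coeffs_prod
      nonneg_coeffs_power assms(1)) (simp add: nonneg_coeffs_def)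

lemma eval_nonneg:
  fixes q :: "'v::finite mpoly"
  assumes "nonneg_coeffs q" "\<And>i. 0 \<le> a i"
  shows "0 \<le> mpoly_eval a q"
  using assms unfolding eval.ev_def mon_val_def nonneg_coeffs_def
  by (intro sum_nonneg mult_nonneg_nonneg prod_nonneg) auto

definition positive_definite :: "'z mpoly \<Rightarrow> bool" where
  "positive_definite h \<longleftrightarrow> (\<forall>z. z \<noteq> (\<lambda>_. 0) \<longrightarrow> 0 < mpoly_eval z h)"

text \<open>The minimum over the unit sphere is attained, and homogeneity carries it to all points.\<close>

lemma positive_definite_form_lower_bound:
  fixes h :: "'z::finite mpoly"
  assumes form: "is_form (2 * l) h" and pd: "positive_definite h"
  shows "\<exists>\<delta>>0. \<forall>z. \<delta> * (\<Sum>i\<in>UNIV. z i ^ 2) ^ l \<le> mpoly_eval z h"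
proof -
  let ?P = "\<lambda>x :: real ^ 'z. mpoly_eval (($) x) h"
  have "compact (sphere (0 :: real ^ 'z) 1)" "sphere (0 :: real ^ 'z) 1 \<noteq> {}"
    by auto
  moreover have "continuous_on (sphere 0 1) ?P"
    unfolding eval.ev_def mon_val_def by (intro continuous_intros)
  ultimately obtain x0 where x0: "norm x0 = 1" "\<And>x. norm x = 1 \<Longrightarrow> ?P x0 \<le> ?P x"
    using continuous_attains_inf[of "sphere 0 1" ?P] by auto
  have "($) x0 \<noteq> (\<lambda>_. 0)"
  proof
    assume "($) x0 = (\<lambda>_. 0)"
    then have "x0 = 0" by (simp add: vec_eq_iff)
    then show False using x0(1) by simp
  qed
  then have pos: "0 < ?P x0"
    using pd by (simp add: positive_definite_def)
  have "?P x0 * (\<Sum>i\<in>UNIV. z i ^ 2) ^ l \<le> mpoly_eval z h" for z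
  proof -
    define v :: "real ^ 'z" where "v = (\<chi> i. z i)"
    define t where "t = norm v"
    \<comment> \<open>For \<open>z = 0\<close> any unit vector serves as the direction; this also covers the degree 0.\<close>
    obtain u where u: "norm u = 1" "v = t *\<^sub>R u"
    proof (cases "v = 0")
      case True
      then show ?thesis using that[of x0] x0(1) by (simp add: t_def)
    next
      case False
      then show ?thesis using that[of "inverse t *\<^sub>R v"] by (simp add: t_def)
    qed
    have "z i = t * u $ i" for i
      using arg_cong[OF u(2), of "\<lambda>w. w $ i"] by (simp add: v_def)
    then have "mpoly_eval z h = mpoly_eval (\<lambda>i. t * u $ i) h"
      by presburger
    also have "\<dots> = t ^ (2 * l) * ?P u"
      by (rule eval_form_scale[OF form])
    finally have eval: "mpoly_eval z h = t ^ (2 * l) * ?P u" .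
    have "t ^ 2 = (\<Sum>i\<in>UNIV. z i ^ 2)"
      unfolding t_def power2_norm_eq_inner by (simp add: inner_vec_def v_def power2_eq_square)
    then have "?P x0 * (\<Sum>i\<in>UNIV. z i ^ 2) ^ l = t ^ (2 * l) * ?P x0"
      by (simp add: power_mult)
    also have "\<dots> \<le> t ^ (2 * l) * ?P u"
      using x0(2)[OF u(1)] by (intro mult_left_mono) (auto simp: power_mult)
    finally show ?thesis using eval by simp
  qed
  with pos show ?thesis by blast
qed

text \<open>
  The form \<open>G\<^sub>r\<close> of the introduction, in variables that stand for the squares of those of the
  certificate; \<open>Inl i\<close> stands for \<open>a\<^sub>i\<close> and \<open>Inr i\<close> for \<open>b\<^sub>i\<close>.
\<close>

definition difference_form :: "'z::finite mpoly \<Rightarrow> nat \<Rightarrow> nat \<Rightarrow> ('z + 'z) mpoly" where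
  "difference_form h d r =
    mpoly_subst (\<lambda>i. Var (Inl i) - Var (Inr i)) h
      - Const (1 / real r) * (\<Sum>i\<in>UNIV. (Var (Inl i) - Var (Inr i))^2)^(2*d)
      + Const (1 / (2 * real r)) * (\<Sum>j\<in>UNIV. (Var j)^2)^(2*d)"

lemma sum_UNIV_Plus:
  fixes F :: "'a::finite + 'b::finite \<Rightarrow> 'c::comm_monoid_add"
  shows "(\<Sum>j\<in>UNIV. F j) = (\<Sum>i\<in>UNIV. F (Inl i)) + (\<Sum>i\<in>UNIV. F (Inr i))"
  using sum.Plus[where A = UNIV and B = UNIV and g = F] by (simp add: comp_def)

lemma certificate_poly_eq_subst:
  "certificate_poly h d r
    = mpoly_subst (\<lambda>j. Var j ^ 2) ((\<Sum>j\<in>UNIV. Var j) ^ (r^2) * difference_form h d r)"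
  unfolding certificate_poly_def difference_form_def Let_def
  by (simp add: subst.ev_simps subst.ev_mpoly_subst sum_UNIV_Plus sum.distrib mult.commute
      flip: power_mult)

lemma is_form_difference_form:
  fixes h :: "'z::finite mpoly"
  assumes "is_form (4 * d) h"
  shows "is_form (4 * d) (difference_form h d r)"
proof -
  have v: "is_form 1 (Var (Inl i) - Var (Inr i) :: ('z + 'z) mpoly)" for i
    by (intro is_form_diff is_form_Var)
  have sq: "is_form (0 + 2 * d * (2 * 1)) (Const a * (\<Sum>j\<in>UNIV. (Var j)^2)^(2*d) :: ('z + 'z) mpoly)" for a
    by (intro is_form_mult is_form_Const is_form_power is_form_sum is_form_Var)
  have sq': "is_form (0 + 2 * d * (2 * 1))
      (Const a * (\<Sum>i\<in>UNIV. (Var (Inl i) - Var (Inr i))^2)^(2*d) :: ('z + 'z) mpoly)" for a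
    by (intro is_form_mult is_form_Const is_form_power is_form_sum v)
  have "0 + 2 * d * (2 * 1) = 4 * d" by simp
  then show ?thesis
    unfolding difference_form_def
    using is_form_subst[OF v assms] sq sq' by (intro is_form_add is_form_diff) simp_all
qed

text \<open>
  A bound on the coefficients that is uniform in \<open>r\<close> is what makes the exponent needed in Polya's
  theorem grow no faster than the reciprocal of the minimum, that is, linearly in \<open>r\<close>.
\<close>

lemma coeff_norm_difference_form_bounded:
  fixes h :: "'z::finite mpoly"
  shows "\<exists>L. \<forall>r>0. coeff_norm (difference_form h d r) \<le> L"
proof -
  let ?H = "mpoly_subst (\<lambda>i. Var (Inl i) - Var (Inr i)) h :: ('z + 'z) mpoly"
  let ?A = "(\<Sum>i\<in>UNIV. (Var (Inl i) - Var (Inr i))^2)^(2*d) :: ('z + 'z) mpoly"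
  let ?B = "(\<Sum>j\<in>UNIV. (Var j)^2)^(2*d) :: ('z + 'z) mpoly"
  have nonneg: "0 \<le> coeff_norm q" for q :: "('z + 'z) mpoly"
    by (simp add: coeff_norm_def sum_nonneg)
  have "coeff_norm (difference_form h d r) \<le> coeff_norm ?H + coeff_norm ?A + coeff_norm ?B"
    if r: "0 < r" for r
  proof -
    have eq: "difference_form h d r = ?H + Const (- 1 / real r) * ?A + Const (1 / (2 * real r)) * ?B"
    proof -
      have "Const (- 1 / real r) * ?A = - (Const (1 / real r) * ?A)"
        by (simp add: Const_def single_uminus)
      then show ?thesis by (simp add: difference_form_def)
    qed
    have le: "coeff_norm (Const a * q) \<le> coeff_norm q" if "\<bar>a\<bar> \<le> 1" for a and q :: "('z + 'z) mpoly"
      using coeff_norm_Const_mult[of a q] mult_right_mono[OF that nonneg[of q]] by simp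
    have "coeff_norm (difference_form h d r) \<le> coeff_norm ?H + coeff_norm (Const (- 1 / real r) * ?A)
        + coeff_norm (Const (1 / (2 * real r)) * ?B)"
      unfolding eq by (intro order_trans[OF coeff_norm_add_le] add_mono coeff_norm_add_le order_refl)
    moreover have "coeff_norm (Const (- 1 / real r) * ?A) \<le> coeff_norm ?A"
      using r by (intro le) (auto simp: divide_simps)
    moreover have "coeff_norm (Const (1 / (2 * real r)) * ?B) \<le> coeff_norm ?B"
      using r by (intro le) (auto simp: divide_simps)
    ultimately show ?thesis by linarith
  qed
  then show ?thesis by blast
qed

lemma eval_difference_form:
  "mpoly_eval x (difference_form h d r) = mpoly_eval (\<lambda>i. x (Inl i) - x (Inr i)) h
     - 1 / real r * (\<Sum>i\<in>UNIV. (x (Inl i) - x (Inr i))^2) ^ (2*d)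
     + 1 / (2 * real r) * (\<Sum>j\<in>UNIV. (x j)^2) ^ (2*d)"
  unfolding difference_form_def by (simp add: eval.ev_simps eval.ev_mpoly_subst)

lemma simplex_sum_squares_lower_bound:
  fixes x :: "'a::finite \<Rightarrow> real"
  assumes "(\<Sum>i\<in>UNIV. x i) = 1"
  shows "1 / real CARD('a) \<le> (\<Sum>i\<in>UNIV. (x i)^2)"
  using sum_squared_le_sum_of_squares[of x UNIV] assms
  by (simp add: divide_simps mult.commute)

text \<open>
  The number \<open>r\<close> has to meet two demands: \<open>1/r \<le> \<delta>\<close>, so that \<open>h(a - b)\<close> absorbs the negative term,
  and \<open>(4d)\<^sup>2 L \<le> c/(2r) \<cdot> r\<^sup>2 = c r / 2\<close>, so that the exponent \<open>r\<^sup>2\<close> is large enough for Polya's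
  theorem with the minimum \<open>c/(2r)\<close>.
\<close>

lemma certificate_of_positive_definite:
  fixes h :: "'z::finite mpoly"
  assumes form: "is_form (4 * d) h" and pd: "positive_definite h"
  shows "\<exists>r>0. nonneg_coeffs (certificate_poly h d r)"
proof -
  let ?D = "4 * d"
  have "is_form (2 * (2 * d)) h" using form by simp
  from positive_definite_form_lower_bound[OF this pd] obtain \<delta> where
    \<delta>: "0 < \<delta>" "\<And>z. \<delta> * (\<Sum>i\<in>UNIV. z i ^ 2) ^ (2 * d) \<le> mpoly_eval z h" by blast
  obtain L where L: "\<And>r. 0 < r \<Longrightarrow> coeff_norm (difference_form h d r) \<le> L"
    using coeff_norm_difference_form_bounded by blast
  define c where "c = (1 / real CARD('z + 'z)) ^ (2 * d)"
  have c: "0 < c" by (simp add: c_def)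
  obtain r :: nat where r: "max (1 / \<delta>) (2 * real ?D ^ 2 * L / c) < real r"
    using reals_Archimedean2 by blast
  have r0: "0 < real r"
    using r \<delta>(1) by (meson less_max_iff_disj max_less_iff_conj less_trans zero_less_divide_1_iff)
  have lower: "c / (2 * real r) \<le> mpoly_eval x (difference_form h d r)"
    if x: "(\<Sum>j\<in>UNIV. x j) = 1" for x :: "'z + 'z \<Rightarrow> real"
  proof -
    let ?s = "(\<Sum>i\<in>UNIV. (x (Inl i) - x (Inr i))^2) ^ (2*d)"
    have s: "0 \<le> ?s" by (simp add: sum_nonneg)
    have "1 / real r \<le> \<delta>"
      using r r0 \<delta>(1) by (simp add: field_simps)
    from mult_right_mono[OF this s]
    have "1 / real r * ?s \<le> mpoly_eval (\<lambda>i. x (Inl i) - x (Inr i)) h"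
      using \<delta>(2)[of "\<lambda>i. x (Inl i) - x (Inr i)"] by linarith
    moreover have "c \<le> (\<Sum>j\<in>UNIV. (x j)^2) ^ (2*d)"
      unfolding c_def using simplex_sum_squares_lower_bound[OF x] by (intro power_mono) auto
    then have "c / (2 * real r) \<le> 1 / (2 * real r) * (\<Sum>j\<in>UNIV. (x j)^2) ^ (2*d)"
      using r0 by (simp add: divide_right_mono)
    ultimately show ?thesis
      unfolding eval_difference_form by linarith
  qed
  have "real ?D ^ 2 * coeff_norm (difference_form h d r) \<le> real ?D ^ 2 * L"
    using L[of r] r0 by (intro mult_left_mono) auto
  also have "\<dots> \<le> c / (2 * real r) * real r ^ 2"
    using r r0 c by (simp add: field_simps power2_eq_square)
  also have "\<dots> \<le> c / (2 * real r) * real (r ^ 2 + ?D)"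
    using r0 c by (intro mult_left_mono) auto
  finally have "nonneg_coeffs ((\<Sum>j\<in>UNIV. Var j) ^ (r^2) * difference_form h d r)"
    using r0 lower by (intro polya_bound[OF is_form_difference_form[OF form], of "c / (2 * real r)"]) auto
  then have "nonneg_coeffs (certificate_poly h d r)"
    unfolding certificate_poly_eq_subst
    by (intro nonneg_coeffs_subst nonneg_coeffs_power nonneg_coeffs_Var)
  then show ?thesis using r0 by auto
qed

text \<open>
  The certificate is evaluated at the square roots of the positive and negative parts of \<open>z\<close>. Since
  one of the two parts vanishes in each coordinate, the two norms in \<open>G\<^sub>r\<close> agree there and leave
  \<open>h(z)\<close> minus a positive quantity.
\<close>

lemma positive_definite_of_certificate:
  fixes h :: "'z::finite mpoly"
  assumes r: "0 < r" and cert: "nonneg_coeffs (certificate_poly h d r)"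
  shows "positive_definite h"
  unfolding positive_definite_def
proof (intro allI impI)
  fix z :: "'z \<Rightarrow> real" assume "z \<noteq> (\<lambda>_. 0)"
  then obtain k where k: "z k \<noteq> 0" by auto
  define b where "b = case_sum (\<lambda>i. max (z i) 0) (\<lambda>i. max (- z i) 0)"
  have b: "b (Inl i) - b (Inr i) = z i" "(b (Inl i))^2 + (b (Inr i))^2 = (z i)^2"
      "b (Inl i) + b (Inr i) = \<bar>z i\<bar>" for i
    by (auto simp: b_def max_def)
  have b0: "0 \<le> b j" for j by (cases j) (auto simp: b_def)
  let ?q = "(\<Sum>i\<in>UNIV. (z i)^2) ^ (2*d)"
  have "0 < (\<Sum>i\<in>UNIV. \<bar>z i\<bar>)"
    using k by (intro sum_pos2[of _ k]) auto
  then have sum_pos: "0 < (\<Sum>j\<in>UNIV. b j)"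
    by (simp add: sum_UNIV_Plus sum.distrib[symmetric] b)
  have "0 \<le> mpoly_eval (\<lambda>j. sqrt (b j)) (certificate_poly h d r)"
    using b0 by (intro eval_nonneg cert) auto
  also have "\<dots> = (\<Sum>j\<in>UNIV. b j) ^ (r^2) * mpoly_eval b (difference_form h d r)"
    unfolding certificate_poly_eq_subst by (simp add: eval.ev_simps eval.ev_mpoly_subst b0)
  finally have "0 \<le> mpoly_eval b (difference_form h d r)"
    using zero_less_power[OF sum_pos, of "r^2"] by (simp add: zero_le_mult_iff not_le[symmetric])
  also have "\<dots> = mpoly_eval z h - 1 / (2 * real r) * ?q"
    using r by (simp add: eval_difference_form sum_UNIV_Plus sum.distrib[symmetric] b field_simps)
  finally have "1 / (2 * real r) * ?q \<le> mpoly_eval z h" by simp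
  moreover have "0 < (\<Sum>i\<in>UNIV. (z i)^2)"
    using k by (intro sum_pos2[of _ k]) auto
  then have "0 < 1 / (2 * real r) * ?q"
    using r by (intro mult_pos_pos zero_less_power) auto
  ultimately show "0 < mpoly_eval z h" by linarith
qed

section \<open>The form attached to the constraints\<close>

lemma mon_degree_le_total_degree: "m \<in> keys q \<Longrightarrow> mon_degree m \<le> total_degree q"
  by (simp add: total_degree_def)

lemma is_form_h_form:
  fixes p :: "'n::finite mpoly" and g :: "'m::finite \<Rightarrow> 'n mpoly"
  assumes d: "1 \<le> d" and p: "total_degree p \<le> 2 * d" and g: "\<And>i. total_degree (g i) \<le> 2 * d"
  shows "is_form (4 * d) (h_form p g R \<eta> \<beta> d)"
proof -
  have hom: "is_form (2 * d) (homogenization (2 * d) (\<lambda>i. Var (X i)) (Var Y) q :: ('n, 'm) zvar mpoly)"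
    if "total_degree q \<le> 2 * d" for q :: "'n mpoly"
    using that by (intro is_form_homogenization is_form_Var) (meson mon_degree_le_total_degree order_trans)
  have slack: "is_form (2 * d) (Var s ^ 2 * Var Y ^ (2 * d - 2) :: ('n, 'm) zvar mpoly)" for s
  proof -
    have "2 * 1 + (2 * d - 2) * 1 = 2 * d" using d by simp
    moreover have "is_form (2 * 1 + (2 * d - 2) * 1) (Var s ^ 2 * Var Y ^ (2 * d - 2) :: ('n, 'm) zvar mpoly)"
      by (intro is_form_mult is_form_power is_form_Var)
    ultimately show ?thesis by simp
  qed
  have sq: "is_form (4 * d) (q ^ 2)" if "is_form (2 * d) q" for q :: "('n, 'm) zvar mpoly"
    using is_form_power[OF that, of 2] by simp
  have var: "is_form k (Var s ^ k :: ('n, 'm) zvar mpoly)" for s k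
    using is_form_power[OF is_form_Var, of k s] by simp
  have "is_form (d * 2) (((\<Sum>i\<in>UNIV. (Var (X i))^2)
      + ((Var Slack0)^2 + (\<Sum>i\<in>UNIV. (Var (Slack i))^2)))^d :: ('n, 'm) zvar mpoly)"
    by (intro is_form_power[of 2] is_form_add is_form_sum var)
  then have ball: "is_form (2 * d) (((\<Sum>i\<in>UNIV. (Var (X i))^2)
      + ((Var Slack0)^2 + (\<Sum>i\<in>UNIV. (Var (Slack i))^2)))^d :: ('n, 'm) zvar mpoly)"
    by (simp only: mult.commute)
  have const: "is_form (2 * d) (Const a * Var Y ^ (2 * d) :: ('n, 'm) zvar mpoly)" for a
    using is_form_mult[OF is_form_Const var] by simp
  show ?thesis
    unfolding h_form_def Let_def
    by (intro is_form_add is_form_sum sq is_form_diff hom p g slack ball const var)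
qed

lemma eval_h_form:
  fixes z :: "('n::finite, 'm::finite) zvar \<Rightarrow> real"
  shows "mpoly_eval z (h_form p g R \<eta> \<beta> d) =
    (mpoly_eval z (homogenization (2*d) (\<lambda>i. Var (X i)) (Var Y) p)
        + (z Slack0)^2 * z Y ^ (2*d - 2))^2
    + (\<Sum>i\<in>UNIV. (mpoly_eval z (homogenization (2*d) (\<lambda>i. Var (X i)) (Var Y) (g i))
        - (z (Slack i))^2 * z Y ^ (2*d - 2))^2)
    + ((R + (\<Sum>i\<in>UNIV. \<eta> i) + \<beta>)^d * z Y ^ (2*d)
        - ((\<Sum>i\<in>UNIV. (z (X i))^2) + ((z Slack0)^2 + (\<Sum>i\<in>UNIV. (z (Slack i))^2)))^d
        - z SlackLast ^ (2*d))^2"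
  unfolding h_form_def Let_def by (simp add: eval.ev_simps)

lemma eval_homogenization_affine:
  fixes z :: "('n::finite, 'm::finite) zvar \<Rightarrow> real"
  assumes "total_degree q \<le> k" "z Y \<noteq> 0"
  shows "mpoly_eval z (homogenization k (\<lambda>i. Var (X i)) (Var Y) q)
    = z Y ^ k * mpoly_eval (\<lambda>i. z (X i) / z Y) q"
  using assms mon_degree_le_total_degree[of _ q]
  by (subst eval_homogenization) (auto simp: eval.ev_Var intro: order_trans)

text \<open>
  A point \<open>x\<close> of \<open>S\<close> with \<open>p(x) \<le> 0\<close> gives the zero of \<open>h\<close> whose slack variables are the roots
  of \<open>- p(x)\<close>, of the \<open>g\<^sub>i(x)\<close> and of the defect in the bound, with \<open>y = 1\<close>. Conversely, at a zero of
  \<open>h\<close> all three kinds of squares vanish. If \<open>y = 0\<close>, the last of them forces all other variables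
  to vanish. Otherwise the point \<open>x/y\<close> lies in \<open>S\<close> and \<open>p\<close> is not positive there.
\<close>

lemma positive_definite_h_form_iff:
  fixes p :: "'n::finite mpoly" and g :: "'m::finite \<Rightarrow> 'n mpoly"
  assumes R: "\<forall>x\<in>semialg_set g. (\<Sum>i\<in>UNIV. (x $ i)^2) \<le> R"
    and \<eta>: "\<forall>i. \<forall>x\<in>semialg_set g. mpoly_eval (($) x) (g i) \<le> \<eta> i"
    and \<beta>: "\<forall>x\<in>semialg_set g. - mpoly_eval (($) x) p \<le> \<beta>"
    and d: "1 \<le> d" and p: "total_degree p \<le> 2 * d" and g: "\<And>i. total_degree (g i) \<le> 2 * d"
  shows "positive_definite (h_form p g R \<eta> \<beta> d) \<longleftrightarrow> (\<forall>x\<in>semialg_set g. 0 < mpoly_eval (($) x) p)"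
    (is "positive_definite ?h \<longleftrightarrow> _")
proof
  assume pd: "positive_definite ?h"
  show "\<forall>x\<in>semialg_set g. 0 < mpoly_eval (($) x) p"
  proof (rule ballI, rule ccontr)
    fix x assume x: "x \<in> semialg_set g" and "\<not> 0 < mpoly_eval (($) x) p"
    then have p_le: "mpoly_eval (($) x) p \<le> 0" by simp
    let ?g = "\<lambda>i. mpoly_eval (($) x) (g i)"
    \<comment> \<open>The sum of the squares of all \<open>x\<^sub>i\<close> and of the slack variables \<open>s\<^sub>0, \<dots>, s\<^sub>m\<close>.\<close>
    define S where "S = (\<Sum>i\<in>UNIV. (x $ i)^2) + (- mpoly_eval (($) x) p + (\<Sum>i\<in>UNIV. ?g i))"
    define K where "K = R + (\<Sum>i\<in>UNIV. \<eta> i) + \<beta>"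
    have g_ge: "0 \<le> ?g i" for i using x by (simp add: semialg_set_def)
    have "0 \<le> S"
      unfolding S_def using p_le g_ge by (intro add_nonneg_nonneg sum_nonneg) auto
    moreover have "S \<le> K"
      using sum_mono[of UNIV ?g \<eta>] R \<eta> \<beta> x unfolding S_def K_def by fastforce
    ultimately have "S ^ d \<le> K ^ d" by (intro power_mono)
    define z :: "('n, 'm) zvar \<Rightarrow> real" where
      "z = case_zvar (($) x) (sqrt (- mpoly_eval (($) x) p)) (\<lambda>i. sqrt (?g i)) (root (2 * d) (K ^ d - S ^ d)) 1"
    have last: "z SlackLast ^ (2 * d) = K ^ d - S ^ d"
      using \<open>S ^ d \<le> K ^ d\<close> d by (simp add: z_def real_root_pow_pos2)
    have z_Y: "z Y = 1" and z_X: "\<And>i. z (X i) = x $ i"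
      by (simp_all add: z_def)
    have z_Slack0: "(z Slack0)^2 = - mpoly_eval (($) x) p"
      using p_le by (simp add: z_def)
    have z_Slack: "(z (Slack i))^2 = ?g i" for i
      using g_ge[of i] by (simp add: z_def)
    have hom: "mpoly_eval z (homogenization (2*d) (\<lambda>i. Var (X i)) (Var Y) q) = mpoly_eval (($) x) q"
      if "total_degree q \<le> 2 * d" for q
      using that by (simp add: eval_homogenization_affine z_Y z_X)
    have "(\<Sum>i\<in>UNIV. (z (X i))^2) + ((z Slack0)^2 + (\<Sum>i\<in>UNIV. (z (Slack i))^2)) = S"
      by (simp add: S_def z_X z_Slack0 z_Slack)
    then have "mpoly_eval z ?h = 0"
      unfolding eval_h_form last K_def[symmetric]
      by (simp add: hom p g z_Y z_Slack0 z_Slack)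
    moreover have "z \<noteq> (\<lambda>_. 0)"
      using z_Y by (metis zero_neq_one)
    ultimately show False
      using pd unfolding positive_definite_def by (metis less_irrefl)
  qed
next
  assume pos: "\<forall>x\<in>semialg_set g. 0 < mpoly_eval (($) x) p"
  show "positive_definite ?h"
    unfolding positive_definite_def
  proof (intro allI impI, rule ccontr)
    fix z :: "('n, 'm) zvar \<Rightarrow> real"
    assume nz: "z \<noteq> (\<lambda>_. 0)" and "\<not> 0 < mpoly_eval z ?h"
    define y where "y = z Y"
    define Q where "Q q = mpoly_eval z (homogenization (2*d) (\<lambda>i. Var (X i)) (Var Y) q)" for q
    define T where "T = (\<Sum>i\<in>UNIV. (z (X i))^2) + ((z Slack0)^2 + (\<Sum>i\<in>UNIV. (z (Slack i))^2))"
    define K where "K = R + (\<Sum>i\<in>UNIV. \<eta> i) + \<beta>"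
    let ?a = "(Q p + (z Slack0)^2 * y ^ (2*d - 2))^2"
    let ?b = "\<lambda>i. (Q (g i) - (z (Slack i))^2 * y ^ (2*d - 2))^2"
    let ?c = "(K ^ d * y ^ (2*d) - T ^ d - z SlackLast ^ (2*d))^2"
    have "mpoly_eval z ?h = ?a + (\<Sum>i\<in>UNIV. ?b i) + ?c"
      unfolding eval_h_form Q_def y_def T_def K_def ..
    moreover have "0 \<le> ?a" "0 \<le> (\<Sum>i\<in>UNIV. ?b i)" "0 \<le> ?c"
      by (simp_all add: sum_nonneg)
    ultimately have "?a = 0" "(\<Sum>i\<in>UNIV. ?b i) = 0" "?c = 0"
      using \<open>\<not> 0 < mpoly_eval z ?h\<close> by linarith+
    then have a: "Q p + (z Slack0)^2 * y ^ (2*d - 2) = 0"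
      and b: "\<And>i. Q (g i) - (z (Slack i))^2 * y ^ (2*d - 2) = 0"
      and c: "K ^ d * y ^ (2*d) - T ^ d - z SlackLast ^ (2*d) = 0"
      by (simp_all add: sum_nonneg_eq_0_iff)
    have T0: "0 \<le> T"
      unfolding T_def by (intro add_nonneg_nonneg sum_nonneg) auto
    show False
    proof (cases "y = 0")
      case True
      have "0 \<le> T ^ d" "0 \<le> z SlackLast ^ (2*d)"
        using T0 by (simp_all add: power_mult)
      moreover have "K ^ d * y ^ (2*d) = 0"
        using True d by simp
      ultimately have "T ^ d = 0" and last: "z SlackLast ^ (2*d) = 0"
        using c by linarith+
      then have "T = 0" by simp
      moreover have "0 \<le> (\<Sum>i\<in>UNIV. (z (X i))^2)" "0 \<le> (z Slack0)^2" "0 \<le> (\<Sum>i\<in>UNIV. (z (Slack i))^2)"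
        by (simp_all add: sum_nonneg)
      ultimately have "(\<Sum>i\<in>UNIV. (z (X i))^2) = 0" "(z Slack0)^2 = 0" "(\<Sum>i\<in>UNIV. (z (Slack i))^2) = 0"
        unfolding T_def by linarith+
      then have "z v = 0" for v
        using last True by (cases v) (auto simp: sum_nonneg_eq_0_iff y_def)
      with nz show False by auto
    next
      case False
      define x :: "real ^ 'n" where "x = (\<chi> i. z (X i) / y)"
      have x: "($) x = (\<lambda>i. z (X i) / y)" by (auto simp: x_def)
      have Q: "Q q = y ^ (2*d) * mpoly_eval (($) x) q" if "total_degree q \<le> 2 * d" for q
        unfolding Q_def x y_def using that False by (intro eval_homogenization_affine) (auto simp: y_def)
      have "2 + (2*d - 2) = 2 * d" and half: "2*d - 2 = 2 * (d - 1)"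
        using d by auto
      then have y1: "y ^ (2*d) = y^2 * y ^ (2*d - 2)"
        by (simp flip: power_add)
      have y3: "0 < y^2"
        using False by simp
      then have y2: "0 < y ^ (2*d - 2)"
        unfolding half power_mult by (rule zero_less_power)
      have "y ^ (2*d - 2) * (y^2 * mpoly_eval (($) x) (g i)) = y ^ (2*d - 2) * (z (Slack i))^2" for i
        using b[of i] Q[OF g] y1 by (simp add: algebra_simps)
      then have "y^2 * mpoly_eval (($) x) (g i) = (z (Slack i))^2" for i
        using y2 False by simp
      then have "0 \<le> y^2 * mpoly_eval (($) x) (g i)" for i by simp
      then have "x \<in> semialg_set g"
        using y3 by (simp add: semialg_set_def zero_le_mult_iff)
      then have "0 < y ^ (2*d) * mpoly_eval (($) x) p"
        using pos y2 y3 unfolding y1 by simp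
      moreover have "0 \<le> (z Slack0)^2 * y ^ (2*d - 2)" using y2 by simp
      ultimately show False
        using a Q[OF p] by linarith
    qed
  qed
qed

theorem corollary4p4p5:
  fixes p :: "'n::finite mpoly"
    and g :: "'m::finite \<Rightarrow> 'n mpoly"
    and R \<beta> :: real
    and \<eta> :: "'m \<Rightarrow> real"
    and d :: nat
  assumes "R > 0"
    and "\<forall>x\<in>semialg_set g. (\<Sum>i\<in>UNIV. (x $ i)^2) \<le> R"
    and "\<forall>i. \<forall>x\<in>semialg_set g. mpoly_eval (($) x) (g i) \<le> \<eta> i"
    and "\<forall>x\<in>semialg_set g. - mpoly_eval (($) x) p \<le> \<beta>"
    and "d \<ge> 1"
    and "2 * d = (LEAST k. 0 < k \<and> even k \<and>
           Max (insert (total_degree p) (range (\<lambda>i. total_degree (g i)))) \<le> k)"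
  shows "(\<forall>x\<in>semialg_set g. 0 < mpoly_eval (($) x) p) \<longleftrightarrow>
    (\<exists>r::nat. 0 < r \<and>
      (\<forall>mon. 0 \<le> mpoly_coeff (certificate_poly (h_form p g R \<eta> \<beta> d) d r) mon))"
proof -
  let ?h = "h_form p g R \<eta> \<beta> d"
  define M where "M = Max (insert (total_degree p) (range (\<lambda>i. total_degree (g i))))"
  have "0 < 2 * M + 2 \<and> even (2 * M + 2) \<and> M \<le> 2 * M + 2"
    by simp
  then have "M \<le> (LEAST k. 0 < k \<and> even k \<and> M \<le> k)"
    using LeastI[of "\<lambda>k. 0 < k \<and> even k \<and> M \<le> k"] by blast
  then have M: "M \<le> 2 * d"
    unfolding M_def assms(6) .
  have "total_degree p \<le> M" and "\<And>i. total_degree (g i) \<le> M"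
    unfolding M_def by (intro Max_ge; simp)+
  then have deg: "total_degree p \<le> 2 * d" "\<And>i. total_degree (g i) \<le> 2 * d"
    using M order_trans by blast+
  have form: "is_form (4 * d) ?h"
    by (rule is_form_h_form[OF assms(5) deg])
  have pd: "positive_definite ?h \<longleftrightarrow> (\<forall>x\<in>semialg_set g. 0 < mpoly_eval (($) x) p)"
    by (rule positive_definite_h_form_iff[OF assms(2-5) deg])
  have "positive_definite ?h \<longleftrightarrow> (\<exists>r>0. nonneg_coeffs (certificate_poly ?h d r))"
  proof
    assume "positive_definite ?h"
    then show "\<exists>r>0. nonneg_coeffs (certificate_poly ?h d r)"
      by (rule certificate_of_positive_definite[OF form])
  next
    assume "\<exists>r>0. nonneg_coeffs (certificate_poly ?h d r)"
    then obtain r where "0 < r" "nonneg_coeffs (certificate_poly ?h d r)" by blast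
    then show "positive_definite ?h"
      by (rule positive_definite_of_certificate)
  qed
  then show ?thesis
    unfolding pd nonneg_coeffs_def mpoly_coeff_def .
qed

end
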